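(* Let $J$ be any subset of the simple roots. Assume $w\in W$ has the parabolic decomposition $w=u\cdot v$ with $u\in W_J$ and $v\in W^J$ and furthermore $u=m(w,J)$. Then $$P_w(t)=P_u(t)\,P^{W^J}_v(t),$$ where $P^{W^J}_v(t)=\sum_{z\in W^J,\ z\le v}t^{\ell(z)}$ is the Poincar\'e polynomial for $v$ in the quotient.
   Context: $W$ is the Weyl group of a root system $\Phi$ with positive roots $\Phi_+$, $\ell$ is the length function, and $\le$ is the Bruhat order. For $w\in W$, $P_w(t)=\sum_{x\le w}t^{\ell(x)}$. For a subset $J$ of the simple roots, $W_J$ is the parabolic subgroup generated by the simple reflections corresponding to $J$, $\Phi^J$ is the root subsystem spanned by $J$, $\Phi^J_+=\Phi^J\cap\Phi_+$, and $$W^J=\{v\in W\mid v^{-1}(\alpha)\in\Phi_+\text{ for any }\alpha\in\Phi^J_+\}$$ is the set of minimal length coset representatives for $W_J\backslash W$. Every $w\in W$ has a unique parabolic decomposition $w=uv$ with $u\in W_J$, $v\in W^J$, and then $\ell(w)=\ell(u)+\ell(v)$. For any $w\in W$ and $J$, the parabolic subgroup $W_J$ has a unique maximal element below $w$ in the Bruhat order (a known fact); it is denoted $m(w,J)\in W_J$. *)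

theory Defs
  imports
    "HOL-Analysis.Analysis"
    "HOL-Algebra.Bij"
    "HOL-Algebra.Generated_Groups"
    "HOL-Computational_Algebra.Polynomial"
begin

definition root_reflection :: "'a::euclidean_space \<Rightarrow> 'a \<Rightarrow> 'a" where
  "root_reflection \<alpha> x = x - (2 * (x \<bullet> \<alpha>) / (\<alpha> \<bullet> \<alpha>)) *\<^sub>R \<alpha>"

(* Reduced crystallographic root systems. The roots need not span the ambient space: a root
   system is viewed as a root system in its own span, so the empty one is included. *)
definition root_system :: "'a::euclidean_space set \<Rightarrow> bool" where
  "root_system \<Phi> \<longleftrightarrow>
     finite \<Phi> \<and> 0 \<notin> \<Phi> \<and>
     (\<forall>\<alpha>\<in>\<Phi>. root_reflection \<alpha> ` \<Phi> \<subseteq> \<Phi>) \<and>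
     (\<forall>\<alpha>\<in>\<Phi>. \<forall>c. c *\<^sub>R \<alpha> \<in> \<Phi> \<longrightarrow> c = 1 \<or> c = -1) \<and>
     (\<forall>\<alpha>\<in>\<Phi>. \<forall>\<beta>\<in>\<Phi>. 2 * (\<beta> \<bullet> \<alpha>) / (\<alpha> \<bullet> \<alpha>) \<in> \<int>)"

definition positive_roots :: "'a::euclidean_space set \<Rightarrow> 'a set \<Rightarrow> 'a set" where
  "positive_roots \<Phi> \<Delta> = {\<beta> \<in> \<Phi>. \<exists>c :: 'a \<Rightarrow> nat. \<beta> = (\<Sum>\<alpha>\<in>\<Delta>. real (c \<alpha>) *\<^sub>R \<alpha>)}"

(* A choice of positive roots is given by its simple roots. *)
definition simple_roots :: "'a::euclidean_space set \<Rightarrow> 'a set \<Rightarrow> bool" where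
  "simple_roots \<Phi> \<Delta> \<longleftrightarrow>
     \<Delta> \<subseteq> \<Phi> \<and> independent \<Delta> \<and>
     (\<forall>\<beta>\<in>\<Phi>. \<beta> \<in> positive_roots \<Phi> \<Delta> \<or> - \<beta> \<in> positive_roots \<Phi> \<Delta>)"

(* The subgroup of the bijections of the ambient space generated by the reflections in A.
   For A = \<Phi> this is the Weyl group W, for a set A = J of simple roots it is W_J. *)
definition reflection_group :: "'a::euclidean_space set \<Rightarrow> ('a \<Rightarrow> 'a) set" where
  "reflection_group A = generate (BijGroup UNIV) (root_reflection ` A)"

definition weyl_length :: "'a::euclidean_space set \<Rightarrow> ('a \<Rightarrow> 'a) \<Rightarrow> nat" where
  "weyl_length \<Delta> w =
     (LEAST n. \<exists>as. set as \<subseteq> \<Delta> \<and> length as = n \<and> w = foldr (\<circ>) (map root_reflection as) id)"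

definition bruhat_step :: "'a::euclidean_space set \<Rightarrow> 'a set \<Rightarrow> ('a \<Rightarrow> 'a) \<Rightarrow> ('a \<Rightarrow> 'a) \<Rightarrow> bool" where
  "bruhat_step \<Phi> \<Delta> x y \<longleftrightarrow>
     x \<in> reflection_group \<Phi> \<and> weyl_length \<Delta> x < weyl_length \<Delta> y \<and>
     (\<exists>\<alpha>\<in>\<Phi>. y = x \<circ> root_reflection \<alpha>)"

definition bruhat_le :: "'a::euclidean_space set \<Rightarrow> 'a set \<Rightarrow> ('a \<Rightarrow> 'a) \<Rightarrow> ('a \<Rightarrow> 'a) \<Rightarrow> bool" where
  "bruhat_le \<Phi> \<Delta> = (bruhat_step \<Phi> \<Delta>)\<^sup>*\<^sup>*"

(* W^J; the set \<Phi> \<inter> span J is the root subsystem spanned by J. *)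
definition min_coset_reps :: "'a::euclidean_space set \<Rightarrow> 'a set \<Rightarrow> 'a set \<Rightarrow> ('a \<Rightarrow> 'a) set" where
  "min_coset_reps \<Phi> \<Delta> J =
     {v \<in> reflection_group \<Phi>.
        \<forall>\<alpha> \<in> (\<Phi> \<inter> span J) \<inter> positive_roots \<Phi> \<Delta>. inv_into UNIV v \<alpha> \<in> positive_roots \<Phi> \<Delta>}"

(* m(w, J): the unique maximal element of W_J below w. *)
definition parabolic_max ::
    "'a::euclidean_space set \<Rightarrow> 'a set \<Rightarrow> ('a \<Rightarrow> 'a) \<Rightarrow> 'a set \<Rightarrow> ('a \<Rightarrow> 'a)" where
  "parabolic_max \<Phi> \<Delta> w J =
     (THE x. x \<in> reflection_group J \<and> bruhat_le \<Phi> \<Delta> x w \<and>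
        (\<forall>y \<in> reflection_group J. bruhat_le \<Phi> \<Delta> y w \<longrightarrow> bruhat_le \<Phi> \<Delta> x y \<longrightarrow> y = x))"

definition poincare_poly :: "'a::euclidean_space set \<Rightarrow> 'a set \<Rightarrow> ('a \<Rightarrow> 'a) \<Rightarrow> int poly" where
  "poincare_poly \<Phi> \<Delta> w =
     (\<Sum>x \<in> {x \<in> reflection_group \<Phi>. bruhat_le \<Phi> \<Delta> x w}. monom 1 (weyl_length \<Delta> x))"

definition quotient_poincare_poly ::
    "'a::euclidean_space set \<Rightarrow> 'a set \<Rightarrow> 'a set \<Rightarrow> ('a \<Rightarrow> 'a) \<Rightarrow> int poly" where
  "quotient_poincare_poly \<Phi> \<Delta> J v =
     (\<Sum>z \<in> {z \<in> min_coset_reps \<Phi> \<Delta> J. bruhat_le \<Phi> \<Delta> z v}. monom 1 (weyl_length \<Delta> z))"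

end

theory Submission
  imports Defs
begin

text \<open>
  Write \<open>\<le>\<close> for the Bruhat order. The lifting property says that \<open>x \<le> y\<close> implies
  \<open>x \<le> s y\<close> or \<open>s x \<le> s y\<close>, and also \<open>s x \<le> y\<close> or \<open>s x \<le> s y\<close>, for every simple
  reflection \<open>s\<close>. Stripping the letters of a reduced word of \<open>u\<close> from the left, it shows that
  \<open>x \<le> u\<close> and \<open>z \<le> v\<close> imply \<open>x z \<le> u v\<close>, and that an element of \<open>W\<^sup>J\<close> below \<open>u v\<close> lies below \<open>v\<close>.
  Conversely, the \<open>W\<^sub>J\<close>-part of an element below \<open>w\<close> is itself below \<open>w\<close>, hence below
  \<open>m(w, J) = u\<close>, because the elements of \<open>W\<^sub>J\<close> below \<open>w\<close> have a greatest one (again by lifting).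
  So \<open>(x, z) \<mapsto> x z\<close> is a length-additive bijection from \<open>[e, u] \<times> [e, v]\<^sup>J\<close> onto \<open>[e, w]\<close>.
\<close>

section \<open>Reflections\<close>

lemma root_reflection_zero [simp]: "root_reflection 0 = id"
  by (auto simp: root_reflection_def)

lemma linear_root_reflection: "linear (root_reflection \<alpha>)"
  by (rule linearI)
     (auto simp: root_reflection_def inner_add_left algebra_simps add_divide_distrib)

lemma root_reflection_involutive [simp]: "root_reflection \<alpha> (root_reflection \<alpha> x) = x"
proof (cases "\<alpha> = 0")
  case False
  have "root_reflection \<alpha> x \<bullet> \<alpha> = - (x \<bullet> \<alpha>)"
    using False by (simp add: root_reflection_def inner_diff_left)
  then show ?thesis
    by (simp add: root_reflection_def algebra_simps)
qed simp

lemma root_reflection_o_self [simp]: "root_reflection \<alpha> \<circ> root_reflection \<alpha> = id"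
  by auto

lemma root_reflection_o_cancel [simp]:
  "root_reflection \<alpha> \<circ> (root_reflection \<alpha> \<circ> f) = f"
  by (simp add: comp_assoc [symmetric])

lemma root_reflection_self: "root_reflection \<alpha> \<alpha> = - \<alpha>"
proof (cases "\<alpha> = 0")
  case False
  then have "2 * (\<alpha> \<bullet> \<alpha>) / (\<alpha> \<bullet> \<alpha>) = 2"
    by simp
  then show ?thesis
    by (simp only: root_reflection_def) (simp add: scaleR_2)
qed simp

lemma root_reflection_uminus [simp]: "root_reflection (- \<alpha>) = root_reflection \<alpha>"
  by (auto simp: root_reflection_def)

lemma inner_root_reflection [simp]: "root_reflection \<alpha> x \<bullet> root_reflection \<alpha> y = x \<bullet> y"
proof (cases "\<alpha> = 0")
  case False
  then show ?thesis
    by (simp add: root_reflection_def inner_diff_left inner_diff_right inner_commute field_simps)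
qed simp

section \<open>Words in reflections and the groups they generate\<close>

definition reflection_prod :: "'a::euclidean_space list \<Rightarrow> 'a \<Rightarrow> 'a" where
  "reflection_prod as = foldr (\<circ>) (map root_reflection as) id"

lemma reflection_prod_Nil [simp]: "reflection_prod [] = id"
  by (simp add: reflection_prod_def)

lemma reflection_prod_Cons [simp]:
  "reflection_prod (a # as) = root_reflection a \<circ> reflection_prod as"
  by (simp add: reflection_prod_def)

lemma reflection_prod_append [simp]:
  "reflection_prod (as @ bs) = reflection_prod as \<circ> reflection_prod bs"
  by (induction as) (auto simp: comp_assoc)

lemma reflection_prod_rev_o: "reflection_prod (rev as) \<circ> reflection_prod as = id"
  by (induction as) (auto simp: fun_eq_iff)

lemma reflection_prod_o_rev: "reflection_prod as \<circ> reflection_prod (rev as) = id"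
  using reflection_prod_rev_o [of "rev as"] by simp

lemma bij_reflection_prod: "bij (reflection_prod as)"
  using reflection_prod_rev_o reflection_prod_o_rev o_bij by blast

lemma inv_reflection_prod: "inv_into UNIV (reflection_prod as) = reflection_prod (rev as)"
  using reflection_prod_rev_o reflection_prod_o_rev inv_unique_comp by blast

lemma linear_reflection_prod: "linear (reflection_prod as)"
  by (induction as) (simp_all only: reflection_prod_Nil reflection_prod_Cons linear_id linear_compose linear_root_reflection)

lemma inner_reflection_prod [simp]: "reflection_prod as x \<bullet> reflection_prod as y = x \<bullet> y"
  by (induction as) auto

text \<open>A product of reflections is a linear isometry, and
  \<open>root_reflection \<beta>\<close> is built from inner products with \<beta> and multiples of
  \<beta>.\<close>

lemma root_reflection_conjugate:
  "root_reflection (reflection_prod as \<beta>) \<circ> reflection_prod as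
     = reflection_prod as \<circ> root_reflection \<beta>"
  by (rule ext)
     (simp add: root_reflection_def linear_diff [OF linear_reflection_prod]
        linear_scale [OF linear_reflection_prod])

lemma BijGroup_UNIV_simps:
  "carrier (BijGroup UNIV) = {f. bij f}"
  "\<one>\<^bsub>BijGroup UNIV\<^esub> = id"
  "bij f \<Longrightarrow> bij g \<Longrightarrow> f \<otimes>\<^bsub>BijGroup UNIV\<^esub> g = f \<circ> g"
  by (auto simp: BijGroup_def Bij_def compose_def fun_eq_iff)

lemma inv_BijGroup_UNIV_root_reflection:
  "inv\<^bsub>BijGroup UNIV\<^esub> root_reflection \<alpha> = root_reflection \<alpha>"
proof -
  have "bij (root_reflection \<alpha>)"
    using bij_reflection_prod [of "[\<alpha>]"] by simp
  then show ?thesis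
    by (intro group.inv_equality [OF group_BijGroup]) (auto simp: BijGroup_UNIV_simps)
qed

lemma reflection_group_eq: "reflection_group A = reflection_prod ` {as. set as \<subseteq> A}"
proof (intro equalityI subsetI)
  fix f assume "f \<in> reflection_group A"
  then have "f \<in> generate (BijGroup UNIV) (root_reflection ` A)"
    by (simp add: reflection_group_def)
  then have "\<exists>as. set as \<subseteq> A \<and> f = reflection_prod as"
  proof (induction rule: generate.induct)
    case one
    show ?case by (intro exI [of _ "[]"]) (simp add: BijGroup_UNIV_simps)
  next
    case (incl h)
    then obtain a where "a \<in> A" "h = root_reflection a" by auto
    then show ?case by (intro exI [of _ "[a]"]) simp
  next
    case (inv h)
    then obtain a where "a \<in> A" "h = root_reflection a" by auto
    then show ?case
      by (intro exI [of _ "[a]"]) (simp add: inv_BijGroup_UNIV_root_reflection)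
  next
    case (eng h1 h2)
    then obtain as bs where
      *: "set as \<subseteq> A" "h1 = reflection_prod as" "set bs \<subseteq> A" "h2 = reflection_prod bs"
      by auto
    then show ?case
      by (intro exI [of _ "as @ bs"]) (simp add: BijGroup_UNIV_simps bij_reflection_prod)
  qed
  then show "f \<in> reflection_prod ` {as. set as \<subseteq> A}" by auto
next
  fix f assume "f \<in> reflection_prod ` {as. set as \<subseteq> A}"
  then obtain as where as: "set as \<subseteq> A" "f = reflection_prod as" by auto
  have "reflection_prod as \<in> generate (BijGroup UNIV) (root_reflection ` A)"
    using as(1)
  proof (induction as)
    case Nil
    show ?case
      using generate.one [of "BijGroup UNIV" "root_reflection ` A"]
      by (simp only: BijGroup_UNIV_simps reflection_prod_Nil)
  next
    case (Cons a as)
    then have "root_reflection a \<otimes>\<^bsub>BijGroup UNIV\<^esub> reflection_prod as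
        \<in> generate (BijGroup UNIV) (root_reflection ` A)"
      by (intro generate.eng [OF generate.incl]) auto
    moreover have "bij (root_reflection a)"
      using bij_reflection_prod [of "[a]"] by simp
    ultimately show ?case
      by (simp only: BijGroup_UNIV_simps bij_reflection_prod reflection_prod_Cons)
  qed
  then show "f \<in> reflection_group A" using as by (simp add: reflection_group_def)
qed

lemma reflection_groupE:
  assumes "w \<in> reflection_group A"
  obtains as where "set as \<subseteq> A" "w = reflection_prod as"
  using assms by (auto simp: reflection_group_eq)

lemma reflection_prod_in_group: "set as \<subseteq> A \<Longrightarrow> reflection_prod as \<in> reflection_group A"
  by (auto simp: reflection_group_eq)

lemma id_in_reflection_group [simp]: "id \<in> reflection_group A"
  using reflection_prod_in_group [of "[]"] by simp

lemma comp_in_reflection_group: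
  assumes "x \<in> reflection_group A" "y \<in> reflection_group A"
  shows "x \<circ> y \<in> reflection_group A"
proof -
  obtain as bs where "set as \<subseteq> A" "x = reflection_prod as" "set bs \<subseteq> A" "y = reflection_prod bs"
    using assms by (metis reflection_groupE)
  then show ?thesis using reflection_prod_in_group [of "as @ bs" A] by simp
qed

lemma inv_in_reflection_group:
  assumes "x \<in> reflection_group A"
  shows "inv_into UNIV x \<in> reflection_group A"
  using assms by (metis reflection_groupE inv_reflection_prod set_rev reflection_prod_in_group)

lemma root_reflection_in_group: "\<alpha> \<in> A \<Longrightarrow> root_reflection \<alpha> \<in> reflection_group A"
  using reflection_prod_in_group [of "[\<alpha>]"] by simp

lemma reflection_group_mono: "A \<subseteq> B \<Longrightarrow> reflection_group A \<subseteq> reflection_group B"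
  by (auto simp: reflection_group_eq)

lemma bij_reflection_group: "x \<in> reflection_group A \<Longrightarrow> bij x"
  by (auto simp: reflection_group_eq bij_reflection_prod)

lemma linear_reflection_group: "x \<in> reflection_group A \<Longrightarrow> linear x"
  by (auto simp: reflection_group_eq linear_reflection_prod)

lemma reflection_group_conjugate:
  "w \<in> reflection_group A \<Longrightarrow> root_reflection (w \<beta>) \<circ> w = w \<circ> root_reflection \<beta>"
  by (auto simp: reflection_group_eq root_reflection_conjugate)

text \<open>Turns left multiplication by a reflection into right multiplication by another one. The
  Bruhat order is defined by right multiplication, whereas words are stripped from the left.\<close>

lemma reflection_group_conjugate_inv:
  assumes "w \<in> reflection_group A"
  shows "w \<circ> root_reflection (inv_into UNIV w \<alpha>) = root_reflection \<alpha> \<circ> w"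
  using reflection_group_conjugate [OF assms, of "inv_into UNIV w \<alpha>"] bij_reflection_group [OF assms]
  by (simp add: bij_is_surj surj_f_inv_f)

section \<open>Positive roots and length\<close>

locale based_root_system =
  fixes \<Phi> \<Delta> :: "'a::euclidean_space set"
  assumes root_system: "root_system \<Phi>" and simple_roots: "simple_roots \<Phi> \<Delta>"
begin

abbreviation "pos \<equiv> positive_roots \<Phi> \<Delta>"
abbreviation "W \<equiv> reflection_group \<Phi>"
abbreviation "len \<equiv> weyl_length \<Delta>"
abbreviation "\<sigma> \<equiv> root_reflection"
abbreviation "coef \<equiv> representation \<Delta>"
abbreviation bruhat (infix "\<preceq>" 50) where "bruhat \<equiv> bruhat_le \<Phi> \<Delta>"

lemma zero_not_root: "0 \<notin> \<Phi>"
  and refl_root: "\<alpha> \<in> \<Phi> \<Longrightarrow> \<beta> \<in> \<Phi> \<Longrightarrow> \<sigma> \<alpha> \<beta> \<in> \<Phi>"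
  and root_multiple: "\<alpha> \<in> \<Phi> \<Longrightarrow> c *\<^sub>R \<alpha> \<in> \<Phi> \<Longrightarrow> c = 1 \<or> c = -1"
  using root_system unfolding root_system_def by blast+

lemma simple_root: "\<alpha> \<in> \<Delta> \<Longrightarrow> \<alpha> \<in> \<Phi>"
  and indep: "independent \<Delta>"
  and pos_or_neg: "\<beta> \<in> \<Phi> \<Longrightarrow> \<beta> \<in> pos \<or> - \<beta> \<in> pos"
  using simple_roots unfolding simple_roots_def by blast+

lemma finite_simple: "finite \<Delta>"
  using indep independent_imp_finite by blast

lemma pos_root: "\<beta> \<in> pos \<Longrightarrow> \<beta> \<in> \<Phi>"
  by (simp add: positive_roots_def)

section \<open>Positivity of roots read off from their coefficients at the simple roots\<close>

lemma coef_sum: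
  assumes "\<delta> \<in> \<Delta>"
  shows "coef (\<Sum>\<alpha>\<in>\<Delta>. c \<alpha> *\<^sub>R \<alpha>) \<delta> = c \<delta>"
proof -
  have "coef (\<Sum>\<alpha>\<in>\<Delta>. c \<alpha> *\<^sub>R \<alpha>) \<delta> = (\<Sum>\<alpha>\<in>\<Delta>. coef (c \<alpha> *\<^sub>R \<alpha>) \<delta>)"
    by (subst representation_sum [OF indep]) (auto intro: span_scale span_base)
  also have "\<dots> = (\<Sum>\<alpha>\<in>\<Delta>. c \<alpha> * (if \<alpha> = \<delta> then 1 else 0))"
    by (intro sum.cong)
       (auto simp: representation_scale [OF indep] representation_basis [OF indep] span_base)
  also have "\<dots> = (\<Sum>\<alpha>\<in>\<Delta>. if \<alpha> = \<delta> then c \<alpha> else 0)"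
    by (intro sum.cong) auto
  also have "\<dots> = c \<delta>"
    using assms finite_simple by simp
  finally show ?thesis .
qed

lemma pos_coef_nonneg: "\<beta> \<in> pos \<Longrightarrow> \<delta> \<in> \<Delta> \<Longrightarrow> coef \<beta> \<delta> \<ge> 0"
  by (auto simp: positive_roots_def coef_sum)

lemma pos_span: "\<beta> \<in> pos \<Longrightarrow> \<beta> \<in> span \<Delta>"
  unfolding positive_roots_def by (blast intro: span_sum span_scale span_base)

lemma root_span: "\<beta> \<in> \<Phi> \<Longrightarrow> \<beta> \<in> span \<Delta>"
  using pos_or_neg pos_span span_neg by fastforce

lemma sum_coef: "\<beta> \<in> \<Phi> \<Longrightarrow> (\<Sum>\<delta>\<in>\<Delta>. coef \<beta> \<delta> *\<^sub>R \<delta>) = \<beta>"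
  by (rule sum_representation_eq [OF indep]) (auto intro: root_span finite_simple)

lemma coef_uminus: "\<beta> \<in> \<Phi> \<Longrightarrow> coef (- \<beta>) \<delta> = - coef \<beta> \<delta>"
  by (simp add: representation_neg [OF indep root_span])

text \<open>If \<beta> were not positive, its negative would be, and no coefficient of \<beta> could
  be positive. One positive coefficient thus decides the sign.\<close>

lemma posI: "\<beta> \<in> \<Phi> \<Longrightarrow> \<delta> \<in> \<Delta> \<Longrightarrow> coef \<beta> \<delta> > 0 \<Longrightarrow> \<beta> \<in> pos"
  using pos_or_neg pos_coef_nonneg coef_uminus by fastforce

lemma pos_coef_pos:
  assumes "\<beta> \<in> pos" obtains \<delta> where "\<delta> \<in> \<Delta>" "coef \<beta> \<delta> > 0"
proof -
  have "\<exists>\<delta>\<in>\<Delta>. coef \<beta> \<delta> \<noteq> 0"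
  proof (rule ccontr)
    assume "\<not> ?thesis"
    then have "(\<Sum>\<delta>\<in>\<Delta>. coef \<beta> \<delta> *\<^sub>R \<delta>) = 0"
      by (intro sum.neutral) simp
    then show False
      using sum_coef [OF pos_root [OF assms]] zero_not_root pos_root [OF assms] by simp
  qed
  then obtain \<delta> where "\<delta> \<in> \<Delta>" "coef \<beta> \<delta> \<noteq> 0" by blast
  then show ?thesis
    using that [of \<delta>] pos_coef_nonneg [OF assms, of \<delta>] by simp
qed

lemma uminus_not_pos:
  assumes "\<beta> \<in> pos" shows "- \<beta> \<notin> pos"
proof
  assume neg: "- \<beta> \<in> pos"
  obtain \<delta> where "\<delta> \<in> \<Delta>" "coef \<beta> \<delta> > 0" using pos_coef_pos [OF assms] .
  then show False
    using pos_coef_nonneg [OF neg, of \<delta>] coef_uminus [OF pos_root [OF assms], of \<delta>] by simp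
qed

lemma uminus_pos_iff: "\<beta> \<in> \<Phi> \<Longrightarrow> - \<beta> \<in> pos \<longleftrightarrow> \<beta> \<notin> pos"
  using pos_or_neg uminus_not_pos by auto

lemma simple_pos: "\<alpha> \<in> \<Delta> \<Longrightarrow> \<alpha> \<in> pos"
  by (rule posI [of _ \<alpha>]) (auto simp: simple_root representation_basis [OF indep])

lemma coef_diff_simple:
  assumes "\<beta> \<in> \<Phi>" "\<alpha> \<in> \<Delta>"
  shows "coef (\<beta> - k *\<^sub>R \<alpha>) \<delta> = coef \<beta> \<delta> - (if \<alpha> = \<delta> then k else 0)"
  using assms
  by (simp add: representation_diff [OF indep] representation_scale [OF indep]
      representation_basis [OF indep] root_span span_base span_scale)

lemma coef_refl:
  assumes "\<beta> \<in> \<Phi>" "\<alpha> \<in> \<Delta>" "\<delta> \<noteq> \<alpha>"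
  shows "coef (\<sigma> \<alpha> \<beta>) \<delta> = coef \<beta> \<delta>"
  using assms coef_diff_simple by (auto simp: root_reflection_def)

text \<open>\<open>\<sigma> \<alpha>\<close> alters only the coefficient at \<alpha>, and a positive
  root other than \<alpha> has a positive coefficient elsewhere, which survives and decides the
  sign.\<close>

lemma refl_simple_pos:
  assumes "\<alpha> \<in> \<Delta>" "\<beta> \<in> pos" "\<beta> \<noteq> \<alpha>"
  shows "\<sigma> \<alpha> \<beta> \<in> pos"
proof -
  have "\<exists>\<delta>\<in>\<Delta>. \<delta> \<noteq> \<alpha> \<and> coef \<beta> \<delta> > 0"
  proof (rule ccontr)
    assume none: "\<not> ?thesis"
    have zero: "coef \<beta> \<delta> = 0" if "\<delta> \<in> \<Delta>" "\<delta> \<noteq> \<alpha>" for \<delta>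
      using that pos_coef_nonneg [OF assms(2), of \<delta>] none by force
    have "\<beta> = (\<Sum>\<delta>\<in>\<Delta>. coef \<beta> \<delta> *\<^sub>R \<delta>)"
      using sum_coef pos_root assms(2) by simp
    also have "\<dots> = (\<Sum>\<delta>\<in>\<Delta>. if \<delta> = \<alpha> then coef \<beta> \<alpha> *\<^sub>R \<alpha> else 0)"
      by (intro sum.cong) (auto simp: zero)
    also have "\<dots> = coef \<beta> \<alpha> *\<^sub>R \<alpha>"
      using assms(1) finite_simple by simp
    finally have eq: "\<beta> = coef \<beta> \<alpha> *\<^sub>R \<alpha>" .
    then have "coef \<beta> \<alpha> *\<^sub>R \<alpha> \<in> \<Phi>"
      using pos_root [OF assms(2)] by simp
    \<comment> \<open>The root system is reduced: the only multiples of \<alpha> among the roots are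
      \<alpha> and its negative.\<close>
    then have "coef \<beta> \<alpha> = 1 \<or> coef \<beta> \<alpha> = -1"
      using root_multiple [OF simple_root [OF assms(1)]] by blast
    then have "\<beta> = \<alpha> \<or> \<beta> = - \<alpha>"
      using eq by (metis scaleR_minus1_left scaleR_one)
    then show False
      using assms uminus_not_pos [OF simple_pos [OF assms(1)]] by blast
  qed
  then obtain \<delta> where \<delta>: "\<delta> \<in> \<Delta>" "\<delta> \<noteq> \<alpha>" "coef \<beta> \<delta> > 0" by blast
  have root: "\<beta> \<in> \<Phi>" using pos_root assms(2) .
  show ?thesis
  proof (rule posI)
    show "\<sigma> \<alpha> \<beta> \<in> \<Phi>" using simple_root assms(1) root by (intro refl_root)
    show "coef (\<sigma> \<alpha> \<beta>) \<delta> > 0" using coef_refl [OF root assms(1) \<delta>(2)] \<delta>(3) by simp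
  qed (fact \<delta>(1))
qed

section \<open>Action on the roots, exchange, and generation by simple reflections\<close>

lemma reflection_prod_root: "set as \<subseteq> \<Phi> \<Longrightarrow> \<beta> \<in> \<Phi> \<Longrightarrow> reflection_prod as \<beta> \<in> \<Phi>"
  by (induction as) (auto intro: refl_root)

lemma W_root: "w \<in> W \<Longrightarrow> \<beta> \<in> \<Phi> \<Longrightarrow> w \<beta> \<in> \<Phi>"
  by (auto simp: reflection_group_eq reflection_prod_root)

lemma inv_W_root: "w \<in> W \<Longrightarrow> \<beta> \<in> \<Phi> \<Longrightarrow> inv_into UNIV w \<beta> \<in> \<Phi>"
  using W_root inv_in_reflection_group by blast

text \<open>Strong exchange: the deleted letter is the one at which the root \<open>\<beta>\<close> turns negative.\<close>

lemma strong_exchange: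
  assumes "set as \<subseteq> \<Delta>" "\<beta> \<in> pos" "reflection_prod as \<beta> \<notin> pos"
  obtains bs where "set bs \<subseteq> set as" "length as = Suc (length bs)"
    "reflection_prod as \<circ> \<sigma> \<beta> = reflection_prod bs"
proof -
  have "\<exists>bs. set bs \<subseteq> set as \<and> length as = Suc (length bs)
    \<and> reflection_prod as \<circ> \<sigma> \<beta> = reflection_prod bs"
    using assms
  proof (induction as)
    case (Cons a as)
    show ?case
    proof (cases "reflection_prod as \<beta> \<in> pos")
      case False
      moreover have "set as \<subseteq> \<Delta>" using Cons.prems(1) by simp
      ultimately obtain bs where bs: "set bs \<subseteq> set as" "length as = Suc (length bs)"
        "reflection_prod as \<circ> \<sigma> \<beta> = reflection_prod bs"
        using Cons.IH Cons.prems(2) by blast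
      have "reflection_prod (a # as) \<circ> \<sigma> \<beta> = \<sigma> a \<circ> (reflection_prod as \<circ> \<sigma> \<beta>)"
        by (simp add: comp_assoc)
      also have "\<dots> = reflection_prod (a # bs)"
        by (simp only: bs(3) reflection_prod_Cons)
      finally have "reflection_prod (a # as) \<circ> \<sigma> \<beta> = reflection_prod (a # bs)" .
      moreover have "set (a # bs) \<subseteq> set (a # as)" "length (a # as) = Suc (length (a # bs))"
        using bs(1,2) by auto
      ultimately show ?thesis by blast
    next
      case True
      \<comment> \<open>The only positive root that \<open>\<sigma> a\<close> makes non-positive is
        a. Conjugation then turns \<open>\<sigma> \<beta>\<close> on the right of the word
        \<open>as\<close> into \<open>\<sigma> a\<close> on its left, which cancels the letter
        a.\<close>
      then have "reflection_prod as \<beta> = a"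
        using Cons.prems refl_simple_pos [of a "reflection_prod as \<beta>"] by auto
      then have "\<sigma> a \<circ> reflection_prod as = reflection_prod as \<circ> \<sigma> \<beta>"
        using root_reflection_conjugate by metis
      then have "reflection_prod (a # as) \<circ> \<sigma> \<beta> = reflection_prod as"
        by (simp add: comp_assoc)
      moreover have "set as \<subseteq> set (a # as)" "length (a # as) = Suc (length as)"
        by auto
      ultimately show ?thesis by blast
    qed
  qed auto
  then show ?thesis using that by blast
qed

text \<open>Induction on the height, the sum of the coefficients: reflecting \<beta> in a simple
  root with which it has positive inner product keeps it positive and lowers its height, unless
  \<beta> is that simple root.\<close>

lemma root_conjugate_simple:
  assumes "\<beta> \<in> pos"
  shows "\<exists>as \<alpha>. set as \<subseteq> \<Delta> \<and> \<alpha> \<in> \<Delta> \<and> \<beta> = reflection_prod as \<alpha>"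
proof -
  have main: "\<exists>as \<alpha>. set as \<subseteq> \<Delta> \<and> \<alpha> \<in> \<Delta> \<and> \<beta> = reflection_prod as \<alpha>"
    if "\<beta> \<in> pos" "(\<Sum>\<delta>\<in>\<Delta>. coef \<beta> \<delta>) = real n" for n \<beta>
    using that
  proof (induction n arbitrary: \<beta> rule: less_induct)
    case (less n)
    \<comment> \<open>Otherwise expanding one factor of \<open>\<beta> \<bullet> \<beta>\<close> in
      simple roots gives a sum of nonpositive terms.\<close>
    have "\<exists>\<alpha>\<in>\<Delta>. \<beta> \<bullet> \<alpha> > 0"
    proof (rule ccontr)
      assume "\<not> ?thesis"
      then have "(\<Sum>\<delta>\<in>\<Delta>. coef \<beta> \<delta> * (\<beta> \<bullet> \<delta>)) \<le> 0"
        by (intro sum_nonpos mult_nonneg_nonpos) (auto simp: pos_coef_nonneg less.prems not_less)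
      moreover have "\<beta> \<bullet> \<beta> = \<beta> \<bullet> (\<Sum>\<delta>\<in>\<Delta>. coef \<beta> \<delta> *\<^sub>R \<delta>)"
        using sum_coef pos_root less.prems(1) by simp
      ultimately have "\<beta> \<bullet> \<beta> \<le> 0"
        by (simp add: inner_sum_right)
      then show False
        using inner_gt_zero_iff [of \<beta>] zero_not_root pos_root [OF less.prems(1)] by fastforce
    qed
    then obtain \<alpha> where \<alpha>: "\<alpha> \<in> \<Delta>" "\<beta> \<bullet> \<alpha> > 0" by auto
    show ?case
    proof (cases "\<beta> = \<alpha>")
      case True
      then show ?thesis using \<alpha> by (intro exI [of _ "[]"]) auto
    next
      case False
      define k where "k = 2 * (\<beta> \<bullet> \<alpha>) / (\<alpha> \<bullet> \<alpha>)"
      have "\<alpha> \<noteq> 0" using \<alpha>(2) by auto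
      then have "k > 0" using \<alpha>(2) by (simp add: k_def)
      have p: "\<sigma> \<alpha> \<beta> \<in> pos" using refl_simple_pos False \<alpha> less.prems by blast
      have "coef (\<sigma> \<alpha> \<beta>) \<delta> = coef \<beta> \<delta> - (if \<alpha> = \<delta> then k else 0)" for \<delta>
        using coef_diff_simple [OF pos_root [OF less.prems(1)] \<alpha>(1), of k]
        by (simp add: root_reflection_def k_def)
      then have lt: "(\<Sum>\<delta>\<in>\<Delta>. coef (\<sigma> \<alpha> \<beta>) \<delta>) < real n"
        using \<alpha>(1) \<open>k > 0\<close> finite_simple less.prems(2) by (simp add: sum_subtractf)
      \<comment> \<open>Heights of positive roots are natural numbers, which turns the real
        inequality \<open>lt\<close> into a descent in n.\<close>
      obtain c :: "'a \<Rightarrow> nat" where "\<sigma> \<alpha> \<beta> = (\<Sum>\<alpha>\<in>\<Delta>. real (c \<alpha>) *\<^sub>R \<alpha>)"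
        using p by (auto simp: positive_roots_def)
      then have m: "(\<Sum>\<delta>\<in>\<Delta>. coef (\<sigma> \<alpha> \<beta>) \<delta>) = real (\<Sum>\<delta>\<in>\<Delta>. c \<delta>)"
        by (simp add: coef_sum)
      with lt have "(\<Sum>\<delta>\<in>\<Delta>. c \<delta>) < n" by (simp only: of_nat_less_iff)
      from less.IH [OF this p m] obtain as \<gamma> where
        *: "set as \<subseteq> \<Delta>" "\<gamma> \<in> \<Delta>" "\<sigma> \<alpha> \<beta> = reflection_prod as \<gamma>" by auto
      then have "\<beta> = reflection_prod (\<alpha> # as) \<gamma>"
        by (simp only: reflection_prod_Cons comp_apply *(3) [symmetric] root_reflection_involutive)
      moreover have "set (\<alpha> # as) \<subseteq> \<Delta>" using *(1) \<alpha>(1) by simp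
      ultimately show ?thesis using *(2) by blast
    qed
  qed
  obtain c :: "'a \<Rightarrow> nat" where "\<beta> = (\<Sum>\<alpha>\<in>\<Delta>. real (c \<alpha>) *\<^sub>R \<alpha>)"
    using assms by (auto simp: positive_roots_def)
  then have "(\<Sum>\<delta>\<in>\<Delta>. coef \<beta> \<delta>) = real (\<Sum>\<delta>\<in>\<Delta>. c \<delta>)"
    by (simp add: coef_sum)
  then show ?thesis by (rule main [OF assms])
qed

text \<open>Up to sign a root is \<open>reflection_prod as \<alpha>\<close> with \<alpha> simple, so
  its reflection is the word \<open>as @ [\<alpha>] @ rev as\<close>. Hence the minimum in
  \<open>weyl_length\<close> is over a nonempty set for every element of W.\<close>

lemma W_eq: "W = reflection_group \<Delta>"
proof
  show "reflection_group \<Delta> \<subseteq> W"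
    by (intro reflection_group_mono) (auto intro: simple_root)
  have pos: "\<sigma> \<beta> \<in> reflection_group \<Delta>" if \<beta>: "\<beta> \<in> pos" for \<beta>
  proof -
    obtain as \<alpha> where *: "set as \<subseteq> \<Delta>" "\<alpha> \<in> \<Delta>" "\<beta> = reflection_prod as \<alpha>"
      using root_conjugate_simple [OF \<beta>] by auto
    have "\<sigma> \<beta> \<circ> reflection_prod as \<circ> reflection_prod (rev as)
        = reflection_prod as \<circ> \<sigma> \<alpha> \<circ> reflection_prod (rev as)"
      by (simp only: *(3) root_reflection_conjugate)
    then have "\<sigma> \<beta> = reflection_prod (as @ [\<alpha>] @ rev as)"
      by (simp add: comp_assoc reflection_prod_o_rev)
    also have "\<dots> \<in> reflection_group \<Delta>"
      using * by (intro reflection_prod_in_group) auto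
    finally show ?thesis .
  qed
  have refl: "\<sigma> \<beta> \<in> reflection_group \<Delta>" if "\<beta> \<in> \<Phi>" for \<beta>
    using pos_or_neg [OF that] pos [of \<beta>] pos [of "- \<beta>"] by auto
  have "reflection_prod as \<in> reflection_group \<Delta>" if "set as \<subseteq> \<Phi>" for as
    using that
  proof (induction as)
    case (Cons a as)
    then have "\<sigma> a \<circ> reflection_prod as \<in> reflection_group \<Delta>"
      by (intro comp_in_reflection_group refl) auto
    then show ?case by (simp only: reflection_prod_Cons)
  qed (simp only: reflection_prod_Nil id_in_reflection_group)
  then show "W \<subseteq> reflection_group \<Delta>"
    by (auto elim: reflection_groupE)
qed

lemma refl_in_W: "\<alpha> \<in> \<Phi> \<Longrightarrow> \<sigma> \<alpha> \<in> W"
  by (rule root_reflection_in_group)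

lemma refl_o_in_W: "\<alpha> \<in> \<Delta> \<Longrightarrow> w \<in> W \<Longrightarrow> \<sigma> \<alpha> \<circ> w \<in> W"
  by (intro comp_in_reflection_group refl_in_W simple_root)

section \<open>Length and its change under multiplication by a reflection\<close>

lemma len_le: "set as \<subseteq> \<Delta> \<Longrightarrow> len (reflection_prod as) \<le> length as"
  unfolding weyl_length_def reflection_prod_def by (intro Least_le) auto

lemma reduced_word:
  assumes "w \<in> W"
  obtains as where "set as \<subseteq> \<Delta>" "length as = len w" "w = reflection_prod as"
proof -
  have "\<exists>n as. set as \<subseteq> \<Delta> \<and> length as = n \<and> w = foldr (\<circ>) (map root_reflection as) id"
    using assms unfolding W_eq reflection_prod_def [symmetric] by (auto elim!: reflection_groupE)
  from LeastI_ex [OF this] obtain as where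
    "set as \<subseteq> \<Delta>" "length as = len w" "w = foldr (\<circ>) (map root_reflection as) id"
    unfolding weyl_length_def by blast
  then show ?thesis
    by (intro that) (auto simp only: reflection_prod_def)
qed

lemma len_id [simp]: "len id = 0"
  using len_le [of "[]"] by simp

lemma len_eq_0: "w \<in> W \<Longrightarrow> len w = 0 \<Longrightarrow> w = id"
  by (metis reduced_word length_0_conv reflection_prod_Nil)

lemma len_refl_o_le:
  assumes "\<alpha> \<in> \<Delta>" "w \<in> W"
  shows "len (\<sigma> \<alpha> \<circ> w) \<le> Suc (len w)"
proof -
  obtain as where "set as \<subseteq> \<Delta>" "length as = len w" "w = reflection_prod as"
    using reduced_word assms by metis
  then show ?thesis using len_le [of "\<alpha> # as"] assms by simp
qed

text \<open>Strong exchange, applied to a word of minimal length for w, yields a word shorter by one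
  letter.\<close>

lemma len_comp_refl_less:
  assumes "w \<in> W" "\<beta> \<in> pos" "w \<beta> \<notin> pos"
  shows "len (w \<circ> \<sigma> \<beta>) < len w"
proof -
  obtain as where as: "set as \<subseteq> \<Delta>" "length as = len w" "w = reflection_prod as"
    using reduced_word assms by metis
  have "reflection_prod as \<beta> \<notin> pos" using assms(3) unfolding as(3) .
  from strong_exchange [OF as(1) assms(2) this] obtain bs where
    bs: "set bs \<subseteq> set as" "length as = Suc (length bs)"
      "reflection_prod as \<circ> \<sigma> \<beta> = reflection_prod bs" .
  have "len (w \<circ> \<sigma> \<beta>) \<le> length bs"
    unfolding as(3) bs(3) using bs(1) as(1) by (intro len_le) blast
  then show ?thesis using bs(2) as(2) by simp
qed

text \<open>The product \<open>w \<circ> \<sigma> \<beta>\<close> sends \<beta> to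
  \<open>- w \<beta>\<close>, so multiplying it by \<open>\<sigma> \<beta>\<close> again, which
  gives back w, shortens it.\<close>

lemma len_comp_refl_greater:
  assumes "w \<in> W" "\<beta> \<in> pos" "w \<beta> \<in> pos"
  shows "len w < len (w \<circ> \<sigma> \<beta>)"
proof -
  have "(w \<circ> \<sigma> \<beta>) \<beta> = - w \<beta>"
    using linear_neg [OF linear_reflection_group [OF assms(1)]] by (simp add: root_reflection_self)
  then have neg: "(w \<circ> \<sigma> \<beta>) \<beta> \<notin> pos"
    using uminus_not_pos [OF assms(3)] by simp
  have "w \<circ> \<sigma> \<beta> \<in> W"
    by (rule comp_in_reflection_group [OF assms(1) refl_in_W [OF pos_root [OF assms(2)]]])
  then have "len (w \<circ> \<sigma> \<beta> \<circ> \<sigma> \<beta>) < len (w \<circ> \<sigma> \<beta>)"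
    using assms(2) neg by (rule len_comp_refl_less)
  then show ?thesis by (simp add: comp_assoc)
qed

lemma len_comp_refl_iff:
  assumes "w \<in> W" "\<beta> \<in> pos"
  shows "len w < len (w \<circ> \<sigma> \<beta>) \<longleftrightarrow> w \<beta> \<in> pos"
proof (cases "w \<beta> \<in> pos")
  case True
  then show ?thesis using len_comp_refl_greater [OF assms] by blast
next
  case False
  then show ?thesis using len_comp_refl_less [OF assms False] by simp
qed

text \<open>Left multiplication by \<open>\<sigma> \<alpha>\<close> is right multiplication by the
  reflection in the preimage of \<alpha>, so \<open>len_comp_refl_greater\<close> or
  \<open>len_comp_refl_less\<close> applies to this root or to its negative, whichever is
  positive.\<close>

lemma len_refl_o_cases:
  assumes "\<alpha> \<in> \<Delta>" "w \<in> W"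
  shows "inv_into UNIV w \<alpha> \<in> pos \<and> len w < len (\<sigma> \<alpha> \<circ> w) \<or>
    inv_into UNIV w \<alpha> \<notin> pos \<and> len (\<sigma> \<alpha> \<circ> w) < len w"
proof -
  have lin: "linear w" and bij: "bij w" and r: "inv_into UNIV w \<alpha> \<in> \<Phi>"
    using assms linear_reflection_group bij_reflection_group inv_W_root simple_root by blast+
  have w: "w (inv_into UNIV w \<alpha>) = \<alpha>" using bij by (simp add: bij_is_surj surj_f_inv_f)
  show ?thesis
  proof (cases "inv_into UNIV w \<alpha> \<in> pos")
    case True
    then show ?thesis
      using len_comp_refl_greater [OF assms(2) True] w assms simple_pos
      by (simp add: reflection_group_conjugate_inv [OF assms(2)])
  next
    case False
    then have p: "- inv_into UNIV w \<alpha> \<in> pos" using uminus_pos_iff r by blast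
    have "w (- inv_into UNIV w \<alpha>) \<notin> pos"
      using linear_neg [OF lin] w uminus_not_pos simple_pos assms by simp
    then show ?thesis
      using len_comp_refl_less [OF assms(2) p] False
      by (simp add: reflection_group_conjugate_inv [OF assms(2)])
  qed
qed

lemma len_refl_o_iff:
  assumes "\<alpha> \<in> \<Delta>" "w \<in> W"
  shows "len w < len (\<sigma> \<alpha> \<circ> w) \<longleftrightarrow> inv_into UNIV w \<alpha> \<in> pos"
  using len_refl_o_cases [OF assms] by linarith

section \<open>Bruhat order\<close>

lemma bruhat_refl [simp]: "x \<preceq> x"
  by (simp add: bruhat_le_def)

lemma bruhat_trans [trans]: "x \<preceq> y \<Longrightarrow> y \<preceq> z \<Longrightarrow> x \<preceq> z"
  by (auto simp: bruhat_le_def)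

lemma bruhat_stepI: "bruhat_step \<Phi> \<Delta> x y \<Longrightarrow> x \<preceq> y"
  by (auto simp: bruhat_le_def)

lemma bruhat_len:
  assumes "x \<preceq> y" shows "x = y \<or> len x < len y"
  using assms unfolding bruhat_le_def
  by (induction rule: rtranclp_induct) (auto simp: bruhat_step_def)

lemma bruhat_antisym: "x \<preceq> y \<Longrightarrow> y \<preceq> x \<Longrightarrow> x = y"
  by (auto dest!: bruhat_len)

lemma bruhat_id: "x \<preceq> id \<Longrightarrow> x = id"
  by (auto dest!: bruhat_len)

lemma bruhat_W:
  assumes "x \<preceq> y" "y \<in> W" shows "x \<in> W"
  using assms(1) unfolding bruhat_le_def
  by (rule converse_rtranclpE) (auto simp: assms bruhat_step_def)

text \<open>A \<open>bruhat_step\<close> multiplies on the right; the reflection used is the one in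
  the preimage of \<alpha> under w.\<close>

lemma bruhat_refl_o:
  assumes "\<alpha> \<in> \<Delta>" "w \<in> W" "len w < len (\<sigma> \<alpha> \<circ> w)"
  shows "w \<preceq> \<sigma> \<alpha> \<circ> w"
proof (rule bruhat_stepI)
  have "inv_into UNIV w \<alpha> \<in> \<Phi>"
    using inv_W_root [OF assms(2) simple_root [OF assms(1)]] .
  then show "bruhat_step \<Phi> \<Delta> w (\<sigma> \<alpha> \<circ> w)"
    unfolding bruhat_step_def using assms(2,3) reflection_group_conjugate_inv [OF assms(2)] by metis
qed

text \<open>If \<open>\<sigma> \<alpha>\<close> reverses the order of \<open>x\<close> and \<open>y = x \<circ> \<sigma> \<beta>\<close>, then it turns the positive
  root \<open>x \<beta>\<close> negative, so \<open>x \<beta>\<close> is \<open>\<alpha>\<close>.\<close>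

lemma bruhat_step_refl_o:
  assumes "bruhat_step \<Phi> \<Delta> x y" "\<alpha> \<in> \<Delta>"
  shows "\<sigma> \<alpha> \<circ> x \<preceq> \<sigma> \<alpha> \<circ> y \<or> \<sigma> \<alpha> \<circ> x = y"
proof -
  obtain \<gamma> where "\<gamma> \<in> \<Phi>" and y0: "y = x \<circ> \<sigma> \<gamma>" and x: "x \<in> W" and lt: "len x < len y"
    using assms by (auto simp: bruhat_step_def)
  \<comment> \<open>\<gamma> and its negative define the same reflection, so the positive one may be
    taken; the rise in length then says that x keeps it positive.\<close>
  then obtain \<beta> where \<beta>: "\<beta> \<in> pos" and y: "y = x \<circ> \<sigma> \<beta>"
    using pos_or_neg root_reflection_uminus by metis
  have sx: "\<sigma> \<alpha> \<circ> x \<in> W" using refl_o_in_W assms x by blast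
  have xb: "x \<beta> \<in> pos" using lt len_comp_refl_iff x \<beta> y by blast
  show ?thesis
  proof (cases "(\<sigma> \<alpha> \<circ> x) \<beta> \<in> pos")
    case True
    then have "len (\<sigma> \<alpha> \<circ> x) < len (\<sigma> \<alpha> \<circ> y)"
      using len_comp_refl_iff [OF sx \<beta>] y by (simp add: comp_assoc)
    then have "bruhat_step \<Phi> \<Delta> (\<sigma> \<alpha> \<circ> x) (\<sigma> \<alpha> \<circ> y)"
      using sx \<beta> y pos_root by (auto simp: bruhat_step_def comp_assoc)
    then show ?thesis using bruhat_stepI by blast
  next
    case False
    then have "x \<beta> = \<alpha>" using refl_simple_pos assms xb by fastforce
    then show ?thesis using reflection_group_conjugate [OF x, of \<beta>] y by simp
  qed
qed

text \<open>Induction along a chain of Bruhat steps: by \<open>bruhat_step_refl_o\<close>, left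
  multiplication by \<open>\<sigma> \<alpha>\<close> preserves the order of a step or interchanges
  its ends. The disjunctive form avoids distinguishing whether \<open>\<sigma> \<alpha>\<close>
  lengthens x or y.\<close>

lemma bruhat_lifting:
  assumes "x \<preceq> y" "\<alpha> \<in> \<Delta>"
  shows "\<sigma> \<alpha> \<circ> x \<preceq> y \<or> \<sigma> \<alpha> \<circ> x \<preceq> \<sigma> \<alpha> \<circ> y"
    and "x \<preceq> \<sigma> \<alpha> \<circ> y \<or> \<sigma> \<alpha> \<circ> x \<preceq> \<sigma> \<alpha> \<circ> y"
proof -
  have "(\<sigma> \<alpha> \<circ> x \<preceq> y \<or> \<sigma> \<alpha> \<circ> x \<preceq> \<sigma> \<alpha> \<circ> y)
    \<and> (x \<preceq> \<sigma> \<alpha> \<circ> y \<or> \<sigma> \<alpha> \<circ> x \<preceq> \<sigma> \<alpha> \<circ> y)"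
    using assms(1) unfolding bruhat_le_def
  proof (induction rule: rtranclp_induct)
    case (step y z)
    note IH = step.IH [folded bruhat_le_def] and xy = step.hyps(1) [folded bruhat_le_def]
    have yz: "y \<preceq> z" using step.hyps(2) by (rule bruhat_stepI)
    from bruhat_step_refl_o [OF step.hyps(2) assms(2)]
    have "(\<sigma> \<alpha> \<circ> x \<preceq> z \<or> \<sigma> \<alpha> \<circ> x \<preceq> \<sigma> \<alpha> \<circ> z)
      \<and> (x \<preceq> \<sigma> \<alpha> \<circ> z \<or> \<sigma> \<alpha> \<circ> x \<preceq> \<sigma> \<alpha> \<circ> z)"
    proof
      assume "\<sigma> \<alpha> \<circ> y \<preceq> \<sigma> \<alpha> \<circ> z"
      then show ?thesis using IH yz bruhat_trans by blast
    next
      \<comment> \<open>Now \<open>\<sigma> \<alpha> \<circ> z\<close> is y. The first disjunction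
        is the one for y with its sides interchanged, and the second holds because x \<preceq>
        y.\<close>
      assume z: "\<sigma> \<alpha> \<circ> y = z"
      then have "y = \<sigma> \<alpha> \<circ> z" by auto
      then show ?thesis using IH z xy yz bruhat_trans by metis
    qed
    then show ?case unfolding bruhat_le_def .
  qed auto
  then show "\<sigma> \<alpha> \<circ> x \<preceq> y \<or> \<sigma> \<alpha> \<circ> x \<preceq> \<sigma> \<alpha> \<circ> y"
    and "x \<preceq> \<sigma> \<alpha> \<circ> y \<or> \<sigma> \<alpha> \<circ> x \<preceq> \<sigma> \<alpha> \<circ> y" by auto
qed

text \<open>Dropping the first letter of a word of minimal length leaves a shorter element, hence
  one below w; repeating this reaches id.\<close>

lemma id_bruhat:
  assumes "w \<in> W" shows "id \<preceq> w"
  using assms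
proof (induction "len w" arbitrary: w rule: less_induct)
  case less
  obtain as where as: "set as \<subseteq> \<Delta>" "length as = len w" "w = reflection_prod as"
    using reduced_word less.prems by metis
  show ?case
  proof (cases as)
    case (Cons a bs)
    let ?w = "reflection_prod bs"
    have W: "?w \<in> W" using as Cons W_eq reflection_prod_in_group by auto
    have lt: "len ?w < len w" using as Cons len_le [of bs] by auto
    have "id \<preceq> ?w" using less.hyps [OF lt W] .
    also have "?w \<preceq> \<sigma> a \<circ> ?w" using as Cons W lt by (intro bruhat_refl_o) auto
    finally show ?thesis using as Cons by simp
  qed (use as in auto)
qed

end

section \<open>Parabolic decomposition\<close>

locale parabolic = based_root_system +
  fixes J :: "'a set"
  assumes J: "J \<subseteq> \<Delta>"
begin

abbreviation "WJ \<equiv> reflection_group J"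
abbreviation "QJ \<equiv> min_coset_reps \<Phi> \<Delta> J"

lemma WJ_subset: "WJ \<subseteq> W"
  using W_eq reflection_group_mono [OF J] by simp

lemma QJ_W: "v \<in> QJ \<Longrightarrow> v \<in> W"
  by (simp add: min_coset_reps_def)

lemma QJ_pos: "v \<in> QJ \<Longrightarrow> \<alpha> \<in> span J \<Longrightarrow> \<alpha> \<in> pos \<Longrightarrow> inv_into UNIV v \<alpha> \<in> pos"
  using pos_root by (auto simp: min_coset_reps_def)

lemma id_in_QJ: "id \<in> QJ"
  by (simp add: min_coset_reps_def inv_id)

text \<open>J consists of positive roots of the subsystem, so v pulls them back to positive roots.
  With \<open>QJ_I\<close> as converse, membership in \<open>QJ\<close> becomes a condition on
  lengths.\<close>

lemma QJ_len:
  assumes "v \<in> QJ" "\<alpha> \<in> J" shows "len v < len (\<sigma> \<alpha> \<circ> v)"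
proof -
  have "\<alpha> \<in> \<Delta>" using assms J by auto
  moreover have "inv_into UNIV v \<alpha> \<in> pos"
    using assms \<open>\<alpha> \<in> \<Delta>\<close> by (intro QJ_pos simple_pos) (auto intro: span_base)
  ultimately show ?thesis using len_refl_o_iff QJ_W assms by blast
qed

lemma span_J_coef:
  assumes "\<beta> \<in> span J" "\<delta> \<in> \<Delta> - J" shows "coef \<beta> \<delta> = 0"
proof -
  have "representation J \<beta> \<delta> = 0"
    using representation_ne_zero assms(2) by blast
  then show ?thesis
    using representation_extend [OF indep assms(1) J] by simp
qed

text \<open>The length condition makes the preimages of the roots in J positive. A positive root in
  span J is a nonnegative combination of J, so its preimage has nonnegative coefficients and cannot
  be negative.\<close>

lemma QJ_I:
  assumes "v \<in> W" "\<And>\<alpha>. \<alpha> \<in> J \<Longrightarrow> len v < len (\<sigma> \<alpha> \<circ> v)"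
  shows "v \<in> QJ"
proof -
  have simple: "inv_into UNIV v \<alpha> \<in> pos" if "\<alpha> \<in> J" for \<alpha>
    using that assms J len_refl_o_iff by blast
  have lin: "linear (inv_into UNIV v)"
    using assms inv_in_reflection_group linear_reflection_group by blast
  have "inv_into UNIV v \<beta> \<in> pos" if \<beta>: "\<beta> \<in> span J" "\<beta> \<in> pos" for \<beta>
  proof (rule ccontr)
    assume "inv_into UNIV v \<beta> \<notin> pos"
    moreover have root: "inv_into UNIV v \<beta> \<in> \<Phi>" using inv_W_root assms pos_root \<beta> by blast
    ultimately have neg: "- inv_into UNIV v \<beta> \<in> pos" using uminus_pos_iff by blast
    have eq: "inv_into UNIV v \<beta> = (\<Sum>\<delta>\<in>\<Delta>. coef \<beta> \<delta> *\<^sub>R inv_into UNIV v \<delta>)"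
      using sum_coef [OF pos_root [OF \<beta>(2)]] linear_sum [OF lin] linear_scale [OF lin]
      by (metis (no_types, lifting) sum.cong)
    have "coef (inv_into UNIV v \<beta>) \<epsilon> = (\<Sum>\<delta>\<in>\<Delta>. coef \<beta> \<delta> * coef (inv_into UNIV v \<delta>) \<epsilon>)" for \<epsilon>
    proof -
      have sp: "inv_into UNIV v \<delta> \<in> span \<Delta>" if "\<delta> \<in> \<Delta>" for \<delta>
        using that inv_W_root assms simple_root root_span by blast
      then have "coef (inv_into UNIV v \<beta>) = (\<lambda>b. \<Sum>\<delta>\<in>\<Delta>. coef (coef \<beta> \<delta> *\<^sub>R inv_into UNIV v \<delta>) b)"
        unfolding eq by (intro representation_sum [OF indep]) (auto intro: span_scale)
      then show ?thesis
        by (simp add: representation_scale [OF indep sp])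
    qed
    \<comment> \<open>Outside J the first factor vanishes; inside J both factors are
      nonnegative.\<close>
    moreover have "coef \<beta> \<delta> * coef (inv_into UNIV v \<delta>) \<epsilon> \<ge> 0" if "\<delta> \<in> \<Delta>" "\<epsilon> \<in> \<Delta>" for \<delta> \<epsilon>
      using span_J_coef [OF \<beta>(1)] simple pos_coef_nonneg \<beta>(2) that by (cases "\<delta> \<in> J") auto
    ultimately have "coef (inv_into UNIV v \<beta>) \<epsilon> \<ge> 0" if "\<epsilon> \<in> \<Delta>" for \<epsilon>
      using that by (simp add: sum_nonneg)
    then show False
      using pos_coef_pos [OF neg] coef_uminus [OF root] by (metis neg_0_less_iff_less neg_less_0_iff_less not_less)
  qed
  then show ?thesis using assms(1) by (auto simp: min_coset_reps_def)
qed

section \<open>Reduced words over J, additivity of length, and the parabolic decomposition\<close>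

definition reduced_J :: "'a list \<Rightarrow> bool" where
  "reduced_J as \<longleftrightarrow> set as \<subseteq> J \<and>
     (\<forall>bs. set bs \<subseteq> J \<longrightarrow> reflection_prod bs = reflection_prod as \<longrightarrow> length as \<le> length bs)"

lemma reduced_J_Cons:
  assumes "reduced_J (a # as)" shows "reduced_J as"
  unfolding reduced_J_def
proof (intro conjI allI impI)
  show "set as \<subseteq> J" using assms by (simp add: reduced_J_def)
  fix bs assume bs: "set bs \<subseteq> J" "reflection_prod bs = reflection_prod as"
  then have "set (a # bs) \<subseteq> J" "reflection_prod (a # bs) = reflection_prod (a # as)"
    using assms by (simp_all add: reduced_J_def)
  then have "length (a # as) \<le> length (a # bs)"
    using assms unfolding reduced_J_def by blast
  then show "length as \<le> length bs" by simp
qed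

lemma reduced_J_word:
  assumes "x \<in> WJ" obtains as where "reduced_J as" "x = reflection_prod as"
proof -
  define P where "P as \<longleftrightarrow> set as \<subseteq> J \<and> x = reflection_prod as" for as
  obtain as where "P as" using assms reflection_groupE P_def by metis
  define bs where "bs = arg_min length P"
  have "P bs" "\<And>cs. P cs \<Longrightarrow> length bs \<le> length cs"
    using arg_min_nat_lemma [of P as length] \<open>P as\<close> by (auto simp: bs_def)
  then show ?thesis by (intro that [of bs]) (auto simp: P_def reduced_J_def)
qed

lemma reflection_prod_span_J:
  "set as \<subseteq> J \<Longrightarrow> \<beta> \<in> span J \<Longrightarrow> reflection_prod as \<beta> \<in> span J"
  by (induction as) (auto simp: root_reflection_def intro!: span_diff span_scale intro: span_base)

text \<open>The pullback of a letter through the rest of the word is a positive root in span J, and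
  z pulls it back to a positive root; so each letter adds exactly one. With id for z, minimality
  among words over J is seen to be minimality among words over \<Delta>.\<close>

lemma len_reduced_J:
  assumes "reduced_J as" "z \<in> QJ"
  shows "len (reflection_prod as \<circ> z) = length as + len z"
  using assms(1)
proof (induction as)
  case (Cons a as)
  let ?x = "reflection_prod as"
  note red = reduced_J_Cons [OF Cons.prems]
  have J_as: "a \<in> J" "set as \<subseteq> J" using Cons.prems by (auto simp: reduced_J_def)
  then have a: "a \<in> \<Delta>" using J by auto
  have x: "?x \<in> W" using reflection_prod_in_group [OF J_as(2)] WJ_subset by blast
  have IH: "len (?x \<circ> z) = length as + len z" using red by (rule Cons.IH)
  have xz: "?x \<circ> z \<in> W" using comp_in_reflection_group [OF x QJ_W [OF assms(2)]] .
  have inv: "inv_into UNIV (?x \<circ> z) a = inv_into UNIV z (inv_into UNIV ?x a)"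
    using o_inv_distrib [OF bij_reflection_group [OF x] bij_reflection_group [OF QJ_W [OF assms(2)]]]
    by simp
  have sp: "inv_into UNIV ?x a \<in> span J"
    unfolding inv_reflection_prod using J_as
    by (intro reflection_prod_span_J [OF _ span_base]) auto
  have root: "inv_into UNIV ?x a \<in> \<Phi>" using inv_W_root x a simple_root by blast
  \<comment> \<open>Otherwise strong exchange would express \<open>reflection_prod (a # as)\<close>
    by a word two letters shorter, still over J since it only uses letters of
    \<open>as\<close>.\<close>
  have "inv_into UNIV ?x a \<in> pos"
  proof (rule ccontr)
    assume "inv_into UNIV ?x a \<notin> pos"
    then have neg: "- inv_into UNIV ?x a \<in> pos" using root uminus_pos_iff by blast
    have "?x (- inv_into UNIV ?x a) = - a"
      using linear_neg [OF linear_reflection_prod, of as "inv_into UNIV ?x a"]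
        surj_f_inv_f [OF bij_is_surj [OF bij_reflection_prod], of as a] by simp
    then have n: "?x (- inv_into UNIV ?x a) \<notin> pos" using a simple_pos uminus_not_pos by simp
    have "set as \<subseteq> \<Delta>" using J_as J by auto
    from strong_exchange [OF this neg n] obtain bs where
      bs: "set bs \<subseteq> set as" "length as = Suc (length bs)"
        "?x \<circ> \<sigma> (- inv_into UNIV ?x a) = reflection_prod bs" .
    have "reflection_prod (a # as) = ?x \<circ> \<sigma> (inv_into UNIV ?x a)"
      by (simp only: reflection_group_conjugate_inv [OF x] reflection_prod_Cons)
    then have "reflection_prod bs = reflection_prod (a # as)"
      using bs(3) by (simp only: root_reflection_uminus)
    moreover have "set bs \<subseteq> J" using bs(1) J_as(2) by blast
    ultimately have "length (a # as) \<le> length bs"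
      using Cons.prems unfolding reduced_J_def by blast
    then show False using bs by simp
  qed
  then have "inv_into UNIV (?x \<circ> z) a \<in> pos" using inv QJ_pos assms(2) sp by simp
  then have "len (?x \<circ> z) < len (\<sigma> a \<circ> (?x \<circ> z))"
    using len_refl_o_iff a xz by blast
  moreover have "len (\<sigma> a \<circ> (?x \<circ> z)) \<le> Suc (len (?x \<circ> z))"
    using len_refl_o_le a xz by blast
  ultimately have "len (\<sigma> a \<circ> (?x \<circ> z)) = length (a # as) + len z"
    using IH by simp
  then show ?case by (simp only: reflection_prod_Cons comp_assoc)
qed simp

lemma len_comp:
  assumes "x \<in> WJ" "z \<in> QJ" shows "len (x \<circ> z) = len x + len z"
proof -
  obtain as where "reduced_J as" "x = reflection_prod as" using reduced_J_word assms by metis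
  \<comment> \<open>The instance with id identifies \<open>length as\<close> with
    \<open>len x\<close>.\<close>
  then show ?thesis using len_reduced_J [of as z] len_reduced_J [of as id] id_in_QJ assms by simp
qed

text \<open>The element y of \<open>W\<^sub>J\<close> with \<open>y \<circ> z = z'\<close> adds its
  length in passing from z to z', and its inverse does so on the way back, so y has length
  0.\<close>

lemma comp_inject:
  assumes "x \<in> WJ" "z \<in> QJ" "x' \<in> WJ" "z' \<in> QJ" and eq: "x \<circ> z = x' \<circ> z'"
  shows "x = x'" "z = z'"
proof -
  have b: "bij x" "bij x'" using assms bij_reflection_group by blast+
  define y where "y = inv_into UNIV x' \<circ> x"
  have y: "y \<in> WJ" using assms y_def comp_in_reflection_group inv_in_reflection_group by blast
  have bij_y: "bij y" using y bij_reflection_group by blast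
  have "y \<circ> z = inv_into UNIV x' \<circ> (x' \<circ> z')" by (simp add: y_def comp_assoc eq)
  then have yz: "y \<circ> z = z'" using b by (simp add: comp_assoc [symmetric] bij_is_inj)
  then have "inv_into UNIV y \<circ> z' = inv_into UNIV y \<circ> (y \<circ> z)" by simp
  also have "\<dots> = z" using bij_y by (simp add: comp_assoc [symmetric] bij_is_inj)
  finally have "len z = len (inv_into UNIV y) + len z'"
    using len_comp [of "inv_into UNIV y" z'] y inv_in_reflection_group assms by metis
  moreover have "len z' = len y + len z" using len_comp yz y assms by metis
  ultimately have "len y = 0" by simp
  then have "y = id" using len_eq_0 y WJ_subset by blast
  then show "z = z'" using yz by simp
  have "x' \<circ> y = x" by (rule ext) (simp add: y_def surj_f_inv_f [OF bij_is_surj [OF b(2)]])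
  then show "x = x'" using \<open>y = id\<close> by simp
qed

text \<open>By \<open>QJ_I\<close>, an element outside \<open>QJ\<close> is shortened by some letter
  of J on the left; stripping such letters ends in \<open>QJ\<close>.\<close>

lemma parabolic_decomposition:
  assumes "y \<in> W" obtains x z where "x \<in> WJ" "z \<in> QJ" "y = x \<circ> z"
proof -
  have "\<exists>x z. x \<in> WJ \<and> z \<in> QJ \<and> y = x \<circ> z"
    using assms
  proof (induction "len y" arbitrary: y rule: less_induct)
    case less
    show ?case
    proof (cases "y \<in> QJ")
      case True
      then show ?thesis by (intro exI [of _ id] exI [of _ y]) auto
    next
      case False
      then obtain \<alpha> where \<alpha>: "\<alpha> \<in> J" "\<not> len y < len (\<sigma> \<alpha> \<circ> y)"
        using QJ_I less.prems by blast
      then have \<Delta>: "\<alpha> \<in> \<Delta>" using J by auto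
      have "len (\<sigma> \<alpha> \<circ> y) < len y"
        using \<alpha>(2) len_refl_o_cases [OF \<Delta> less.prems] by blast
      moreover have "\<sigma> \<alpha> \<circ> y \<in> W" using \<Delta> less.prems by (rule refl_o_in_W)
      ultimately obtain x z where xz: "x \<in> WJ" "z \<in> QJ" "\<sigma> \<alpha> \<circ> y = x \<circ> z"
        using less.hyps by blast
      have "y = \<sigma> \<alpha> \<circ> (\<sigma> \<alpha> \<circ> y)" by simp
      then have "y = (\<sigma> \<alpha> \<circ> x) \<circ> z" using xz(3) by (simp add: comp_assoc)
      moreover have "\<sigma> \<alpha> \<circ> x \<in> WJ"
        using \<alpha>(1) xz(1) by (intro comp_in_reflection_group root_reflection_in_group)
      ultimately show ?thesis using xz(2) by blast
    qed
  qed
  then show ?thesis using that by blast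
qed

section \<open>Compatibility of the Bruhat order with the parabolic decomposition\<close>

lemma bruhat_reduced_J:
  assumes "reduced_J as" "x \<preceq> reflection_prod as" "v \<in> QJ" "z \<preceq> v"
  shows "x \<in> WJ" "x \<circ> z \<preceq> reflection_prod as \<circ> v"
proof -
  have "x \<in> WJ \<and> x \<circ> z \<preceq> reflection_prod as \<circ> v"
    using assms(1,2)
  proof (induction as arbitrary: x)
    case Nil
    then have "x = id" by (simp only: reflection_prod_Nil bruhat_id)
    moreover have "id \<in> WJ \<and> id \<circ> z \<preceq> id \<circ> v" using assms by simp
    ultimately show ?case by (simp only: reflection_prod_Nil)
  next
    case (Cons a as)
    let ?u = "reflection_prod as"
    note red = reduced_J_Cons [OF Cons.prems(1)]
    have aJ: "a \<in> J" "set as \<subseteq> J" using Cons.prems by (auto simp: reduced_J_def)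
    then have a: "a \<in> \<Delta>" using J by auto
    have uv: "?u \<circ> v \<in> W"
      using comp_in_reflection_group [OF _ QJ_W [OF assms(3)]]
        reflection_prod_in_group [OF aJ(2)] WJ_subset by blast
    \<comment> \<open>Both words are reduced over J, so by additivity of length the letter a adds
      one in front of \<open>?u \<circ> v\<close> as well.\<close>
    have "len (?u \<circ> v) < len (\<sigma> a \<circ> (?u \<circ> v))"
      using len_reduced_J [OF red assms(3)] len_reduced_J [OF Cons.prems(1) assms(3)]
      by (simp add: comp_assoc del: o_apply)
    then have up: "?u \<circ> v \<preceq> \<sigma> a \<circ> (?u \<circ> v)" using a uv by (intro bruhat_refl_o)
    have "x \<preceq> \<sigma> a \<circ> ?u" using Cons.prems(2) by (simp only: reflection_prod_Cons)
    then have "x \<preceq> ?u \<or> \<sigma> a \<circ> x \<preceq> ?u"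
      using bruhat_lifting(2) [of x "\<sigma> a \<circ> ?u" a] a by simp
    then have "x \<in> WJ \<and> x \<circ> z \<preceq> \<sigma> a \<circ> (?u \<circ> v)"
    proof
      assume "x \<preceq> ?u"
      then have "x \<in> WJ \<and> x \<circ> z \<preceq> ?u \<circ> v" using Cons.IH red by blast
      then show ?thesis using up bruhat_trans by blast
    next
      assume "\<sigma> a \<circ> x \<preceq> ?u"
      with red have "\<sigma> a \<circ> x \<in> WJ \<and> \<sigma> a \<circ> x \<circ> z \<preceq> ?u \<circ> v" by (rule Cons.IH)
      then have IH: "\<sigma> a \<circ> x \<in> WJ" "\<sigma> a \<circ> x \<circ> z \<preceq> ?u \<circ> v" by blast+
      have "\<sigma> a \<circ> (\<sigma> a \<circ> x) \<in> WJ"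
        by (rule comp_in_reflection_group [OF root_reflection_in_group [OF aJ(1)] IH(1)])
      then have "x \<in> WJ" by simp
      \<comment> \<open>The first form of lifting restores the letter a; by \<open>up\<close>, both
        outcomes place \<open>x \<circ> z\<close> below
        \<open>\<sigma> a \<circ> (?u \<circ> v)\<close>.\<close>
      moreover have "x \<circ> z \<preceq> ?u \<circ> v \<or> x \<circ> z \<preceq> \<sigma> a \<circ> (?u \<circ> v)"
        using bruhat_lifting(1) [OF IH(2) a] by (simp add: comp_assoc)
      ultimately show ?thesis using up bruhat_trans by blast
    qed
    then show ?case by (simp only: reflection_prod_Cons comp_assoc)
  qed
  then show "x \<in> WJ" "x \<circ> z \<preceq> reflection_prod as \<circ> v" by auto
qed

lemma bruhat_WJ:
  assumes "u \<in> WJ" "x \<preceq> u" shows "x \<in> WJ"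
  using assms reduced_J_word bruhat_reduced_J(1) id_in_QJ bruhat_refl by metis

lemma bruhat_comp_mono:
  assumes "u \<in> WJ" "v \<in> QJ" "x \<preceq> u" "z \<preceq> v" shows "x \<circ> z \<preceq> u \<circ> v"
  using assms reduced_J_word bruhat_reduced_J(2) by metis

text \<open>Lifting strips a letter a of u and leaves z or \<open>\<sigma> a \<circ> z\<close> below
  the rest. As z lies in \<open>QJ\<close>, it is below \<open>\<sigma> a \<circ> z\<close>, so z
  stays below the rest in either case.\<close>

lemma bruhat_QJ_comp:
  assumes "u \<in> WJ" "v \<in> W" "z \<in> QJ" "z \<preceq> u \<circ> v" shows "z \<preceq> v"
proof -
  obtain as where as: "set as \<subseteq> J" "u = reflection_prod as" using assms reflection_groupE by metis
  have "z \<preceq> reflection_prod as \<circ> v \<Longrightarrow> z \<preceq> v"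
    using as(1)
  proof (induction as)
    case (Cons a as)
    have a: "a \<in> \<Delta>" using J Cons.prems by auto
    have up: "z \<preceq> \<sigma> a \<circ> z"
      using QJ_len QJ_W assms Cons.prems a by (intro bruhat_refl_o) auto
    have "z \<preceq> \<sigma> a \<circ> (reflection_prod as \<circ> v)"
      using Cons.prems(1) by (simp only: reflection_prod_Cons comp_assoc)
    then have "z \<preceq> reflection_prod as \<circ> v \<or> \<sigma> a \<circ> z \<preceq> reflection_prod as \<circ> v"
      using bruhat_lifting(2) [of z "\<sigma> a \<circ> (reflection_prod as \<circ> v)" a] a by simp
    then have "z \<preceq> reflection_prod as \<circ> v" using up bruhat_trans by blast
    moreover have "set as \<subseteq> J" using Cons.prems(2) by simp
    ultimately show ?case by (rule Cons.IH)
  qed simp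
  then show ?thesis using as assms by blast
qed

section \<open>The greatest element of \<open>W\<^sub>J\<close> below w\<close>

lemma WJ_inv_simple_pos:
  assumes "y \<in> WJ" "\<alpha> \<in> \<Delta> - J" shows "inv_into UNIV y \<alpha> \<in> pos"
proof -
  obtain as where as: "set as \<subseteq> J" "inv_into UNIV y = reflection_prod as"
    using assms inv_in_reflection_group reflection_groupE by metis
  \<comment> \<open>Reflections in roots of J do not touch the coefficient at \<alpha>, which starts
    out as 1.\<close>
  have "reflection_prod as \<alpha> \<in> \<Phi> \<and> coef (reflection_prod as \<alpha>) \<alpha> = 1"
    using as(1)
  proof (induction as)
    case Nil
    then show ?case using assms simple_root by (simp add: representation_basis [OF indep])
  next
    case (Cons a as)
    then have "a \<in> \<Delta>" "\<alpha> \<noteq> a" using J assms by auto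
    then show ?case using Cons coef_refl refl_root simple_root by simp
  qed
  then show ?thesis using as posI assms by auto
qed

text \<open>Induction on the length of w, written as \<open>\<sigma> a \<circ> w'\<close> with w'
  shorter and m greatest for w'. If a is not in J, then m still serves; if it is, the longer of m
  and \<open>\<sigma> a \<circ> m\<close> does.\<close>

lemma parabolic_greatest_exists:
  assumes "w \<in> W"
  shows "\<exists>m\<in>WJ. m \<preceq> w \<and> (\<forall>y\<in>WJ. y \<preceq> w \<longrightarrow> y \<preceq> m)"
  using assms
proof (induction "len w" arbitrary: w rule: less_induct)
  case less
  obtain as where as: "set as \<subseteq> \<Delta>" "length as = len w" "w = reflection_prod as"
    using reduced_word less.prems by metis
  show ?case
  proof (cases as)
    case Nil
    then have "w = id" using as by simp
    then show ?thesis by (intro bexI [of _ id]) simp_all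
  next
    case (Cons a bs)
    define w' where "w' = reflection_prod bs"
    have a: "a \<in> \<Delta>" and w: "w = \<sigma> a \<circ> w'" using as Cons by (auto simp: w'_def)
    have W: "w' \<in> W" using as Cons W_eq reflection_prod_in_group by (auto simp: w'_def)
    have lt: "len w' < len w" using as Cons len_le [of bs] by (auto simp: w'_def)
    have w'w: "w' \<preceq> w" using W lt a w by (auto intro: bruhat_refl_o)
    have below: "y \<preceq> w' \<or> \<sigma> a \<circ> y \<preceq> w'" if "y \<preceq> w" for y
      using bruhat_lifting(2) [OF that a] w by simp
    obtain m where m: "m \<in> WJ" "m \<preceq> w'" "\<And>y. y \<in> WJ \<Longrightarrow> y \<preceq> w' \<Longrightarrow> y \<preceq> m"
      using less.hyps [OF lt W] by blast
    have mW: "m \<in> W" using m WJ_subset by blast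
    show ?thesis
    proof (cases "a \<in> J")
      case False
      \<comment> \<open>For a outside J, \<open>\<sigma> a\<close> moves y up, so both alternatives
        of \<open>below\<close> put y under w'.\<close>
      have "y \<preceq> w'" if y: "y \<in> WJ" "y \<preceq> w" for y
      proof -
        have "inv_into UNIV y a \<in> pos" using WJ_inv_simple_pos y False a by blast
        then have "y \<preceq> \<sigma> a \<circ> y"
          using y WJ_subset a len_refl_o_iff by (intro bruhat_refl_o) blast+
        then show ?thesis using below y bruhat_trans by blast
      qed
      then show ?thesis using m w'w bruhat_trans by blast
    next
      case True
      then have ra: "\<sigma> a \<circ> y \<in> WJ" if "y \<in> WJ" for y
        using that by (intro comp_in_reflection_group root_reflection_in_group)
      \<comment> \<open>The induction hypothesis bounds y or \<open>\<sigma> a \<circ> y\<close> by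
        m, and in the latter case lifting transfers the bound to y.\<close>
      have key: "y \<preceq> m \<or> y \<preceq> \<sigma> a \<circ> m" if "y \<in> WJ" "y \<preceq> w" for y
        using below [OF that(2)]
      proof
        assume "y \<preceq> w'"
        then show ?thesis using m that by blast
      next
        assume "\<sigma> a \<circ> y \<preceq> w'"
        then have "\<sigma> a \<circ> y \<preceq> m" using m ra that by blast
        then show ?thesis using bruhat_lifting(1) [of "\<sigma> a \<circ> y" m a] a by simp
      qed
      from len_refl_o_cases [OF a mW] consider
        "len m < len (\<sigma> a \<circ> m)" | "len (\<sigma> a \<circ> m) < len m" by blast
      then show ?thesis
      proof cases
        case 1
        then have up: "m \<preceq> \<sigma> a \<circ> m" using a mW by (intro bruhat_refl_o)
        \<comment> \<open>Lifting bounds \<open>\<sigma> a \<circ> m\<close> by w' or by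
          \<open>\<sigma> a \<circ> w'\<close>, which is w.\<close>
        have "\<sigma> a \<circ> m \<preceq> w" using bruhat_lifting(1) [OF m(2) a] w w'w bruhat_trans by blast
        then show ?thesis
          using key up bruhat_trans m(1) ra by (intro bexI [of _ "\<sigma> a \<circ> m"]) blast+
      next
        case 2
        then have "\<sigma> a \<circ> m \<preceq> \<sigma> a \<circ> (\<sigma> a \<circ> m)"
          using a mW by (intro bruhat_refl_o refl_o_in_W) auto
        then have "\<sigma> a \<circ> m \<preceq> m" by simp
        then show ?thesis
          using key bruhat_trans m w'w by (intro bexI [of _ m]) blast+
      qed
    qed
  qed
qed

text \<open>A greatest element is the only maximal one, so the description in
  \<open>parabolic_max\<close> picks it.\<close>

lemma parabolic_max_greatest:
  assumes "w \<in> W" "y \<in> WJ" "y \<preceq> w"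
  shows "y \<preceq> parabolic_max \<Phi> \<Delta> w J"
proof -
  obtain m where m: "m \<in> WJ" "m \<preceq> w" "\<And>y. y \<in> WJ \<Longrightarrow> y \<preceq> w \<Longrightarrow> y \<preceq> m"
    using parabolic_greatest_exists assms by blast
  have "parabolic_max \<Phi> \<Delta> w J = m"
    unfolding parabolic_max_def using m bruhat_antisym by (intro the_equality) blast+
  then show ?thesis using m assms by simp
qed

section \<open>Factorization of the Bruhat interval and of the Poincare polynomial\<close>

lemma bij_betw_parabolic_interval:
  assumes "u \<in> WJ" "v \<in> QJ" "u = parabolic_max \<Phi> \<Delta> (u \<circ> v) J"
  shows "bij_betw (\<lambda>(x, z). x \<circ> z)
    ({x \<in> W. x \<preceq> u} \<times> {z \<in> QJ. z \<preceq> v}) {y \<in> W. y \<preceq> u \<circ> v}"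
  unfolding bij_betw_def
proof
  show "inj_on (\<lambda>(x, z). x \<circ> z) ({x \<in> W. x \<preceq> u} \<times> {z \<in> QJ. z \<preceq> v})"
  proof (rule inj_onI, clarify)
    fix x z x' z'
    assume "x \<preceq> u" "x' \<preceq> u" and Q: "z \<in> QJ" "z' \<in> QJ" and eq: "x \<circ> z = x' \<circ> z'"
    \<comment> \<open>The interval below u stays inside \<open>W\<^sub>J\<close>, which makes
      uniqueness of the decomposition applicable.\<close>
    then have "x \<in> WJ" "x' \<in> WJ" using bruhat_WJ [OF assms(1)] by blast+
    then show "x = x' \<and> z = z'" using comp_inject [of x z x' z'] Q eq by blast
  qed
  have uv: "u \<circ> v \<in> W"
    using comp_in_reflection_group [of u \<Phi> v] assms(1,2) WJ_subset QJ_W by blast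
  show "(\<lambda>(x, z). x \<circ> z) ` ({x \<in> W. x \<preceq> u} \<times> {z \<in> QJ. z \<preceq> v}) = {y \<in> W. y \<preceq> u \<circ> v}"
  proof (intro equalityI subsetI)
    fix y assume "y \<in> (\<lambda>(x, z). x \<circ> z) ` ({x \<in> W. x \<preceq> u} \<times> {z \<in> QJ. z \<preceq> v})"
    then obtain x z where y: "y = x \<circ> z" and xz: "x \<preceq> u" "z \<preceq> v" by auto
    have "y \<preceq> u \<circ> v" unfolding y by (rule bruhat_comp_mono [OF assms(1,2) xz])
    then show "y \<in> {y \<in> W. y \<preceq> u \<circ> v}" using bruhat_W [OF _ uv] by blast
  next
    fix y assume "y \<in> {y \<in> W. y \<preceq> u \<circ> v}"
    then have y: "y \<in> W" "y \<preceq> u \<circ> v" by auto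
    obtain x z where xz: "x \<in> WJ" "z \<in> QJ" "y = x \<circ> z"
      using parabolic_decomposition [OF y(1)] .
    have W: "x \<in> W" "z \<in> W" using xz WJ_subset QJ_W by blast+
    \<comment> \<open>Since id \<preceq> z, monotonicity of the product gives
      \<open>x \<circ> id \<preceq> x \<circ> z\<close>.\<close>
    have "x \<preceq> y" using bruhat_comp_mono [OF xz(1,2) bruhat_refl id_bruhat [OF W(2)]] xz by simp
    \<comment> \<open>The hypothesis that u is m(w, J) enters here.\<close>
    then have "x \<preceq> u"
      using parabolic_max_greatest [OF uv xz(1) bruhat_trans [OF _ y(2)]] assms(3) by simp
    moreover have "z \<preceq> y"
      using bruhat_comp_mono [OF xz(1,2) id_bruhat [OF W(1)] bruhat_refl] xz by simp
    then have "z \<preceq> v"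
      using bruhat_QJ_comp [OF assms(1) QJ_W [OF assms(2)] xz(2) bruhat_trans [OF _ y(2)]] by simp
    ultimately have "(x, z) \<in> {x \<in> W. x \<preceq> u} \<times> {z \<in> QJ. z \<preceq> v}"
      using xz W by blast
    then show "y \<in> (\<lambda>(x, z). x \<circ> z) ` ({x \<in> W. x \<preceq> u} \<times> {z \<in> QJ. z \<preceq> v})"
      by (rule rev_image_eqI) (simp add: xz(3))
  qed
qed

text \<open>The bijection reindexes the sum; as lengths add, each monomial splits into a factor for
  x and one for z, and the double sum becomes a product.\<close>

lemma poincare_poly_parabolic:
  assumes "u \<in> WJ" "v \<in> QJ" "u = parabolic_max \<Phi> \<Delta> (u \<circ> v) J"
  shows "poincare_poly \<Phi> \<Delta> (u \<circ> v) = poincare_poly \<Phi> \<Delta> u * quotient_poincare_poly \<Phi> \<Delta> J v"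
proof -
  let ?A = "{x \<in> W. x \<preceq> u}" and ?B = "{z \<in> QJ. z \<preceq> v}"
  have "poincare_poly \<Phi> \<Delta> (u \<circ> v)
      = (\<Sum>p\<in>?A \<times> ?B. monom 1 (len (case p of (x, z) \<Rightarrow> x \<circ> z)))"
    unfolding poincare_poly_def
    by (rule sum.reindex_bij_betw [OF bij_betw_parabolic_interval [OF assms], symmetric])
  also have "\<dots> = (\<Sum>(x, z)\<in>?A \<times> ?B. monom 1 (len x) * monom 1 (len z))"
  proof (intro sum.cong refl, clarify)
    fix x z assume "x \<preceq> u" and z: "z \<in> QJ"
    then have "len (x \<circ> z) = len x + len z"
      using len_comp [OF bruhat_WJ [OF assms(1)] z] by blast
    then show "monom (1::int) (len (x \<circ> z)) = monom 1 (len x) * monom 1 (len z)"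
      by (simp add: mult_monom)
  qed
  also have "\<dots> = poincare_poly \<Phi> \<Delta> u * quotient_poincare_poly \<Phi> \<Delta> J v"
    unfolding poincare_poly_def quotient_poincare_poly_def sum_product sum.cartesian_product ..
  finally show ?thesis .
qed

end

theorem theorem6p4:
  fixes \<Phi> \<Delta> J :: "'a::euclidean_space set" and w u v :: "'a \<Rightarrow> 'a"
  assumes "root_system \<Phi>" and "simple_roots \<Phi> \<Delta>" and "J \<subseteq> \<Delta>"
    and "w \<in> reflection_group \<Phi>"
    and "u \<in> reflection_group J" and "v \<in> min_coset_reps \<Phi> \<Delta> J" and "w = u \<circ> v"
    and "u = parabolic_max \<Phi> \<Delta> w J"
  shows "poincare_poly \<Phi> \<Delta> w = poincare_poly \<Phi> \<Delta> u * quotient_poincare_poly \<Phi> \<Delta> J v"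
proof -
  interpret parabolic \<Phi> \<Delta> J
    using assms(1-3) by unfold_locales
  show ?thesis
    unfolding \<open>w = u \<circ> v\<close>
    by (rule poincare_poly_parabolic [OF assms(5,6)]) (simp only: assms(7) [symmetric] assms(8) [symmetric])
qed

end
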